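(* Let $l=\{a_i;\ i=1,2,3,\dots\}$ be a bounded sequence of real numbers, i.e. there is a number $m$ such that $|a_i|<m$ for all $i\in\mathbb{N}$, and let $a\in\mathbb{R}$. If $a=\mathrm{stat}\text{-}\lim l$, then $a=\lim\mu(l)$, i.e. $\lim_{n\to\infty}\mu_n=a$.
   Context: $\mathbb{N}=\{1,2,3,\dots\}$. For $K\subseteq\mathbb{N}$ put $K_n=\{k\in K: k\le n\}$; the asymptotic density of $K$ is $d(K)=\lim_{n\to\infty}\frac1n|K_n|$ whenever the limit exists ($|\cdot|$ of a set is its cardinality). A sequence $l=\{a_i\}$ of real numbers is statistically convergent to $a\in\mathbb{R}$, written $a=\mathrm{stat}\text{-}\lim l$, if for every $\varepsilon>0$ the set $\{i\in\mathbb{N}: |a_i-a|\ge\varepsilon\}$ has density $0$. The sequence of partial averages of $l$ is $\mu(l)=\{\mu_n;\ n=1,2,3,\dots\}$ with $\mu_n=\frac1n\sum_{i=1}^n a_i$. *)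

theory Defs
  imports Complex_Main
begin

text \<open>
  Here the natural numbers start at 1. A sequence a_1, a_2, ... is a function on \<^typ>\<open>nat\<close>
  whose value at 0 is irrelevant, and sets of indices only matter through their positive elements.
\<close>

definition initial_part :: "nat set \<Rightarrow> nat \<Rightarrow> nat set" where
  "initial_part K n = {k \<in> K. 1 \<le> k \<and> k \<le> n}"

text \<open>The asymptotic density is partial, hence a relation: the limit exists and equals d.\<close>

definition has_density :: "nat set \<Rightarrow> real \<Rightarrow> bool" where
  "has_density K d \<longleftrightarrow> (\<lambda>n. 1 / real n * real (card (initial_part K n))) \<longlonglongrightarrow> d"

definition stat_lim :: "(nat \<Rightarrow> real) \<Rightarrow> real \<Rightarrow> bool" where
  "stat_lim l a \<longleftrightarrow> (\<forall>\<epsilon>>0. has_density {i. 1 \<le> i \<and> \<bar>l i - a\<bar> \<ge> \<epsilon>} 0)"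

definition partial_average :: "(nat \<Rightarrow> real) \<Rightarrow> nat \<Rightarrow> real" where
  "partial_average l n = 1 / real n * (\<Sum>i=1..n. l i)"

end

theory Submission
  imports Defs
begin

text \<open>
  The distance from the average to \<open>a\<close> is at most the average of the deviations
  \<open>\<bar>l i - a\<bar>\<close>. Fix \<open>\<epsilon> > 0\<close> and call an index exceptional if its deviation is at least \<open>\<epsilon>\<close>.
  Exceptional deviations are at most a constant \<open>C\<close>, because \<open>l\<close> is bounded, and the proportion
  of exceptional indices tends to 0 by statistical convergence. By \<open>partial_average_deviation_le\<close>
  the average deviates from \<open>a\<close> by at most \<open>\<epsilon>\<close> plus \<open>C\<close> times that proportion, and this bound
  is eventually below \<open>2 * \<epsilon>\<close>.
\<close>

text \<open>
  The pointwise bound \<open>\<epsilon> + C\<close> times the indicator of the exceptional set holds at every index,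
  and summing the indicator counts the exceptional indices up to \<open>n\<close>.
\<close>

lemma partial_average_deviation_le:
  fixes l :: "nat \<Rightarrow> real"
  assumes bound: "\<And>i. 1 \<le> i \<Longrightarrow> \<bar>l i - a\<bar> \<le> C" and "0 \<le> \<epsilon>" and "1 \<le> n"
  shows "\<bar>partial_average l n - a\<bar>
    \<le> \<epsilon> + C * (1 / real n * real (card (initial_part {i. 1 \<le> i \<and> \<bar>l i - a\<bar> \<ge> \<epsilon>} n)))"
proof -
  define K where "K = {i. 1 \<le> i \<and> \<bar>l i - a\<bar> \<ge> \<epsilon>}"
  have pointwise: "\<bar>l i - a\<bar> \<le> \<epsilon> + C * of_bool (i \<in> K)" if "i \<in> {1..n}" for i
    using that bound[of i] \<open>0 \<le> \<epsilon>\<close> by (auto simp: K_def)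
  have count: "(\<Sum>i=1..n. of_bool (i \<in> K)) = real (card (initial_part K n))"
  proof -
    have "{1..n} \<inter> {i. i \<in> K} = initial_part K n"
      by (auto simp: initial_part_def)
    then show ?thesis
      by (simp add: sum_of_bool_eq)
  qed
  have "partial_average l n - a = (\<Sum>i=1..n. l i - a) / real n"
    using \<open>1 \<le> n\<close> by (simp add: partial_average_def sum_subtractf field_simps)
  then have "\<bar>partial_average l n - a\<bar> = \<bar>\<Sum>i=1..n. l i - a\<bar> / real n"
    by simp
  also have "\<dots> \<le> (\<Sum>i=1..n. \<bar>l i - a\<bar>) / real n"
    by (intro divide_right_mono sum_abs) simp
  also have "\<dots> \<le> (\<Sum>i=1..n. \<epsilon> + C * of_bool (i \<in> K)) / real n"
    by (intro divide_right_mono sum_mono pointwise) simp_all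
  also have "\<dots> = \<epsilon> + C * (1 / real n * real (card (initial_part K n)))"
    using \<open>1 \<le> n\<close>
    by (simp only: sum.distrib sum_distrib_left[symmetric] count) (simp add: field_simps)
  finally show ?thesis
    by (simp add: K_def)
qed

theorem theorem2p2:
  fixes l :: "nat \<Rightarrow> real" and a :: real
  assumes "\<exists>m. \<forall>i\<ge>1. \<bar>l i\<bar> < m"
    and "stat_lim l a"
  shows "partial_average l \<longlonglongrightarrow> a"
proof (rule tendstoI)
  obtain m where m: "\<And>i. 1 \<le> i \<Longrightarrow> \<bar>l i\<bar> < m"
    using assms(1) by blast
  define C where "C = m + \<bar>a\<bar>"
  have C: "\<bar>l i - a\<bar> \<le> C" if "1 \<le> i" for i
    using m[OF that] by (simp add: C_def)
  fix e :: real
  assume "0 < e"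
  define p where
    "p n = 1 / real n * real (card (initial_part {i. 1 \<le> i \<and> \<bar>l i - a\<bar> \<ge> e / 2} n))" for n
  have "p \<longlonglongrightarrow> 0"
    using assms(2)[unfolded stat_lim_def has_density_def, rule_format, of "e / 2"] \<open>0 < e\<close>
    unfolding p_def by simp
  then have "(\<lambda>n. e / 2 + C * p n) \<longlonglongrightarrow> e / 2 + C * 0"
    by (intro tendsto_intros)
  then have "\<forall>\<^sub>F n in sequentially. e / 2 + C * p n < e"
    by (rule order_tendstoD(2)) (use \<open>0 < e\<close> in simp)
  then show "\<forall>\<^sub>F n in sequentially. dist (partial_average l n) a < e"
    using eventually_ge_at_top[of 1]
  proof eventually_elim
    case (elim n)
    then show ?case
      using partial_average_deviation_le[of l a C "e / 2" n] C elim \<open>0 < e\<close>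
      by (simp add: dist_real_def p_def)
  qed
qed

end
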